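(* Let $G$ be a finite simple graph on $n$ vertices with clique number $\omega$, and suppose $G$ is $(4K_1,\overline{P_3\cup P_2})$-free, i.e. $G$ contains no induced subgraph isomorphic to $4K_1$ and none isomorphic to the complement of $P_3\cup P_2$. Then $n\le 7\omega$ and $\chi(G)\le 4\omega$.
   Context: $4K_1$ is the edgeless graph on $4$ vertices; $P_n$ is the path on $n$ vertices; $H_1\cup H_2$ is the disjoint union; $\overline{H}$ is the complement of $H$. $\chi(G)$ is the chromatic number and $\omega$ the size of a largest clique of $G$. *)

theory Defs
  imports Main
begin

definition simple_graph :: "'a set \<Rightarrow> ('a \<Rightarrow> 'a \<Rightarrow> bool) \<Rightarrow> bool" where
  "simple_graph V E \<longleftrightarrow> finite V \<and> (\<forall>x\<in>V. \<forall>y\<in>V. E x y \<longleftrightarrow> E y x) \<and> (\<forall>x\<in>V. \<not> E x x)"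

definition is_clique :: "'a set \<Rightarrow> ('a \<Rightarrow> 'a \<Rightarrow> bool) \<Rightarrow> 'a set \<Rightarrow> bool" where
  "is_clique V E K \<longleftrightarrow> K \<subseteq> V \<and> (\<forall>x\<in>K. \<forall>y\<in>K. x \<noteq> y \<longrightarrow> E x y)"

definition clique_number :: "'a set \<Rightarrow> ('a \<Rightarrow> 'a \<Rightarrow> bool) \<Rightarrow> nat" where
  "clique_number V E = Max (card ` {K. is_clique V E K})"

definition proper_colouring :: "'a set \<Rightarrow> ('a \<Rightarrow> 'a \<Rightarrow> bool) \<Rightarrow> nat \<Rightarrow> ('a \<Rightarrow> nat) \<Rightarrow> bool" where
  "proper_colouring V E k c \<longleftrightarrow>
     (\<forall>x\<in>V. c x < k) \<and> (\<forall>x\<in>V. \<forall>y\<in>V. E x y \<longrightarrow> c x \<noteq> c y)"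

definition chromatic_number :: "'a set \<Rightarrow> ('a \<Rightarrow> 'a \<Rightarrow> bool) \<Rightarrow> nat" where
  "chromatic_number V E = (LEAST k. \<exists>c. proper_colouring V E k c)"

definition contains_induced :: "'a set \<Rightarrow> ('a \<Rightarrow> 'a \<Rightarrow> bool) \<Rightarrow> 'b set \<Rightarrow> ('b \<Rightarrow> 'b \<Rightarrow> bool) \<Rightarrow> bool" where
  "contains_induced V E W F \<longleftrightarrow>
     (\<exists>f. inj_on f W \<and> f ` W \<subseteq> V \<and> (\<forall>a\<in>W. \<forall>b\<in>W. E (f a) (f b) \<longleftrightarrow> F a b))"

definition fourK1_V :: "nat set" where "fourK1_V = {0..<4}"
definition fourK1_E :: "nat \<Rightarrow> nat \<Rightarrow> bool" where "fourK1_E a b = False"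

definition P3P2_E :: "nat \<Rightarrow> nat \<Rightarrow> bool" where
  "P3P2_E a b \<longleftrightarrow> {a, b} = {0, 1} \<or> {a, b} = {1, 2} \<or> {a, b} = {3, 4}"

definition coP3P2_V :: "nat set" where "coP3P2_V = {0..<5}"
definition coP3P2_E :: "nat \<Rightarrow> nat \<Rightarrow> bool" where
  "coP3P2_E a b \<longleftrightarrow> a \<noteq> b \<and> \<not> P3P2_E a b"

end

theory Submission
  imports Defs
begin

text \<open>
  Pass to the complement \<open>H\<close>, a \<open>K\<^sub>4\<close>-free graph without induced \<open>P\<^sub>3 \<union> P\<^sub>2\<close> whose
  independence number \<open>a\<close> is the clique number of \<open>G\<close>; the bounds say that \<open>H\<close> has at most \<open>7a\<close>
  vertices and can be covered by \<open>4a\<close> cliques.  Both follow if \<open>H\<close> is 7-colourable, the second one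
  because two colour classes induce a bipartite graph, which \<open>a\<close> cliques cover by Koenig's theorem.

  The common non-neighbours of an edge induce a disjoint union of cliques.  If some edge \<open>uv\<close> is
  anticomplete to a triangle \<open>pqr\<close>, a vertex adjacent to exactly one of \<open>u\<close>, \<open>v\<close> misses at most one
  of \<open>p\<close>, \<open>q\<close>, \<open>r\<close>, and 7 colours suffice: 3 for the common non-neighbours of \<open>u\<close> and \<open>v\<close>, and one
  each for the common neighbours of \<open>uv\<close>, \<open>pq\<close>, \<open>pr\<close>, \<open>qr\<close>.  Otherwise common non-neighbourhoods
  of edges are matchings.  If neither \<open>N(u) - N(v)\<close> nor \<open>N(v) - N(u)\<close> contains a 5-cycle for some edge
  \<open>uv\<close>, both are bipartite and again \<open>2 + 1 + 2 + 2\<close> colours suffice.  In the remaining case each edge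
  \<open>uv\<close> has such a 5-cycle, which forces at most 5 common neighbours of \<open>u\<close> and \<open>v\<close>.  Two consecutive
  vertices of a 5-cycle in \<open>N(u)\<close> form a triangle with \<open>u\<close>; sorting the vertices by their adjacency
  to this triangle gives both bounds directly.
\<close>

section \<open>Colourability of vertex sets\<close>

definition colourable :: "'a set \<Rightarrow> ('a \<Rightarrow> 'a \<Rightarrow> bool) \<Rightarrow> nat \<Rightarrow> bool" where
  "colourable X E k \<longleftrightarrow> (\<exists>c. proper_colouring X E k c)"

lemma colourable_mono:
  assumes "colourable Y E k" "X \<subseteq> Y" "k \<le> l"
  shows "colourable X E l"
proof -
  from assms(1) obtain c where c: "proper_colouring Y E k c" by (auto simp: colourable_def)
  have "proper_colouring X E l c"
    using c assms(2,3) unfolding proper_colouring_def by (meson less_le_trans subsetD)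
  then show ?thesis by (auto simp: colourable_def)
qed

lemma colourable_Un:
  assumes "colourable X E k" "colourable Y E l"
  shows "colourable (X \<union> Y) E (k + l)"
proof -
  from assms obtain c d where c: "proper_colouring X E k c" and d: "proper_colouring Y E l d"
    by (auto simp: colourable_def)
  have "proper_colouring (X \<union> Y) E (k + l) (\<lambda>x. if x \<in> X then c x else k + d x)"
    using c d unfolding proper_colouring_def by (auto; fastforce)
  then show ?thesis by (auto simp: colourable_def)
qed

lemma colourable_independent:
  assumes "\<And>x y. x \<in> X \<Longrightarrow> y \<in> X \<Longrightarrow> \<not> E x y"
  shows "colourable X E 1"
  unfolding colourable_def proper_colouring_def
  by (rule exI[of _ "\<lambda>_. 0"]) (use assms in auto)

lemma colourable_card:
  assumes "finite X" "\<And>x. x \<in> X \<Longrightarrow> \<not> E x x"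
  shows "colourable X E (card X)"
proof -
  obtain f where f: "bij_betw f X {0..<card X}"
    using ex_bij_betw_finite_nat[OF assms(1)] by blast
  have "proper_colouring X E (card X) f"
    using f assms(2) unfolding proper_colouring_def bij_betw_def inj_on_def by force
  then show ?thesis by (auto simp: colourable_def)
qed

text \<open>Greedy colouring: the neighbours of the vertex inserted last occupy at most
  \<open>k\<close> of the \<open>Suc k\<close> colours.\<close>

lemma colourable_bounded_degree:
  assumes "finite X"
    and sym: "\<And>x y. E x y \<Longrightarrow> E y x" and irr: "\<And>x. \<not> E x x"
    and deg: "\<And>x. x \<in> X \<Longrightarrow> card {y \<in> X. E x y} \<le> k"
  shows "colourable X E (Suc k)"
  using assms(1) deg
proof (induction X rule: finite_induct)
  case empty
  then show ?case by (auto simp: colourable_def proper_colouring_def)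
next
  case (insert x X)
  have "card {y \<in> X. E z y} \<le> k" if "z \<in> X" for z
  proof -
    have "card {y \<in> X. E z y} \<le> card {y \<in> insert x X. E z y}"
      using insert.hyps by (intro card_mono) auto
    also have "\<dots> \<le> k" using insert.prems that by auto
    finally show ?thesis .
  qed
  then obtain c where c: "proper_colouring X E (Suc k) c"
    using insert.IH by (auto simp: colourable_def)
  let ?N = "{y \<in> insert x X. E x y}"
  have "card (c ` ?N) \<le> k"
    using card_image_le[of ?N c] insert.hyps insert.prems[of x] by fastforce
  then have "\<not> {..<Suc k} \<subseteq> c ` ?N"
    using card_mono[of "c ` ?N" "{..<Suc k}"] insert.hyps by auto
  then obtain j where j: "j < Suc k" "j \<notin> c ` ?N" by blast
  have "proper_colouring (insert x X) E (Suc k) (c(x := j))"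
    unfolding proper_colouring_def
  proof (intro conjI ballI impI)
    fix y assume "y \<in> insert x X"
    then show "(c(x := j)) y < Suc k"
      using c j by (auto simp: proper_colouring_def)
  next
    fix y z assume yz: "y \<in> insert x X" "z \<in> insert x X" "E y z"
    have ne: "y \<noteq> z" using yz irr by blast
    have "c w \<noteq> j" if "w \<in> insert x X" "E x w" for w
      using that j(2) by blast
    then show "(c(x := j)) y \<noteq> (c(x := j)) z"
      using ne yz c sym unfolding proper_colouring_def by (auto; metis)
  qed
  then show ?case by (auto simp: colourable_def)
qed

lemma card_le_2I:
  assumes "finite S"
    and "\<And>a b c. \<lbrakk>a \<in> S; b \<in> S; c \<in> S; a \<noteq> b; a \<noteq> c; b \<noteq> c\<rbrakk> \<Longrightarrow> False"
  shows "card S \<le> 2"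
proof (cases "S = {}")
  case False
  then obtain x where x: "x \<in> S" by blast
  have "card (S - {x}) \<le> Suc 0"
    using assms x by (subst card_le_Suc0_iff_eq) auto
  then show ?thesis using x assms(1) by (simp add: card_Diff_singleton)
qed simp

section \<open>Clique covers of bipartite graphs\<close>

abbreviation compl_rel :: "('a \<Rightarrow> 'a \<Rightarrow> bool) \<Rightarrow> 'a \<Rightarrow> 'a \<Rightarrow> bool" where
  "compl_rel F \<equiv> \<lambda>x y. x \<noteq> y \<and> \<not> F x y"

definition indep :: "('a \<Rightarrow> 'a \<Rightarrow> bool) \<Rightarrow> 'a set \<Rightarrow> bool" where
  "indep F I \<longleftrightarrow> (\<forall>x\<in>I. \<forall>y\<in>I. \<not> F x y)"

text \<open>Koenig's theorem, with clique covers written as colourings of the complement.  If deleting the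
  ends of an edge does not lower the independence number, a maximum independent set \<open>I\<close> avoiding both
  ends splits the graph into two smaller ones with independence numbers \<open>|I \<inter> B|\<close> and \<open>|I \<inter> A|\<close>.\<close>

lemma bipartite_clique_cover:
  fixes F :: "'a \<Rightarrow> 'a \<Rightarrow> bool"
  assumes sym: "\<And>x y. F x y \<Longrightarrow> F y x" and irr: "\<And>x. \<not> F x x"
    and "finite A" "finite B" "A \<inter> B = {}" "indep F A" "indep F B"
    and "\<And>I. I \<subseteq> A \<union> B \<Longrightarrow> indep F I \<Longrightarrow> card I \<le> w"
  shows "colourable (A \<union> B) (compl_rel F) w"
  using assms(3-)
proof (induction "card (A \<union> B)" arbitrary: A B w rule: less_induct)
  case less
  note fin = less.prems(1,2) and disj = less.prems(3) and ind = less.prems(4,5)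
    and bound = less.prems(6)
  show ?case
  proof (cases "\<exists>x\<in>A. \<exists>y\<in>B. F x y")
    case False
    then have "indep F (A \<union> B)" using ind sym unfolding indep_def by blast
    then have "card (A \<union> B) \<le> w" using bound by blast
    moreover have "colourable (A \<union> B) (compl_rel F) (card (A \<union> B))"
      using fin by (intro colourable_card) auto
    ultimately show ?thesis using colourable_mono by blast
  next
    case True
    then obtain x y where xy: "x \<in> A" "y \<in> B" "F x y" by blast
    have w0: "0 < w" using bound[of "{x}"] xy irr by (auto simp: indep_def)
    show ?thesis
    proof (cases "\<forall>I. I \<subseteq> (A - {x}) \<union> (B - {y}) \<longrightarrow> indep F I \<longrightarrow> card I \<le> w - 1")
      case True
      have "card ((A - {x}) \<union> (B - {y})) < card (A \<union> B)"
        using xy fin disj by (intro psubset_card_mono) auto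
      then have "colourable ((A - {x}) \<union> (B - {y})) (compl_rel F) (w - 1)"
        using True fin disj ind by (intro less.hyps) (auto simp: indep_def)
      moreover have "colourable {x, y} (compl_rel F) 1"
        using xy sym by (intro colourable_independent) auto
      ultimately have "colourable ((A - {x}) \<union> (B - {y}) \<union> {x, y}) (compl_rel F) (w - 1 + 1)"
        by (rule colourable_Un)
      then show ?thesis using w0 by (elim colourable_mono) auto
    next
      case False
      then obtain I where I: "I \<subseteq> (A - {x}) \<union> (B - {y})" "indep F I" "card I \<ge> w"
        by (metis Suc_pred' not_less_eq_eq w0)
      have cI: "card (I \<inter> A) + card (I \<inter> B) = card I" "finite I"
      proof -
        show fI: "finite I" using I fin finite_subset by blast
        have "I = (I \<inter> A) \<union> (I \<inter> B)" using I by auto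
        moreover have "(I \<inter> A) \<inter> (I \<inter> B) = {}" using disj by blast
        ultimately show "card (I \<inter> A) + card (I \<inter> B) = card I"
          using card_Un_disjoint[of "I \<inter> A" "I \<inter> B"] fI by auto
      qed
      have cw: "card I = w" using I bound[of I] by (simp add: le_antisym subset_iff) blast
      \<comment> \<open>This part loses \<open>y\<close>, since \<open>I\<close> avoids
        \<open>y\<close>; the other part, below, loses \<open>x\<close>.\<close>
      have "card ((A - I) \<union> (I \<inter> B)) < card (A \<union> B)"
        using xy fin disj I by (intro psubset_card_mono) auto
      then have c1: "colourable ((A - I) \<union> (I \<inter> B)) (compl_rel F) (card (I \<inter> B))"
      proof (intro less.hyps)
        fix J assume J: "J \<subseteq> (A - I) \<union> (I \<inter> B)" "indep F J"
        \<comment> \<open>Points of \<open>J\<close> lie in \<open>A\<close> or in \<open>I\<close>,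
          and both of these are independent, so \<open>I \<inter> A\<close> can be added to
          \<open>J\<close>.\<close>
        have "indep F (J \<union> (I \<inter> A))"
          unfolding indep_def
        proof (intro ballI)
          fix p q assume "p \<in> J \<union> (I \<inter> A)" "q \<in> J \<union> (I \<inter> A)"
          then show "\<not> F p q"
            using J I(2) ind(1) unfolding indep_def by blast
        qed
        then have "card (J \<union> (I \<inter> A)) \<le> w" using J I by (intro bound) auto
        moreover have "card (J \<union> (I \<inter> A)) = card J + card (I \<inter> A)"
          using J disj fin cI finite_subset[OF J(1)] by (intro card_Un_disjoint) auto
        ultimately show "card J \<le> card (I \<inter> B)" using cI cw by linarith
      qed (use fin disj ind cI in \<open>auto simp: indep_def\<close>)
      have "card ((I \<inter> A) \<union> (B - I)) < card (A \<union> B)"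
        using xy fin disj I by (intro psubset_card_mono) auto
      then have c2: "colourable ((I \<inter> A) \<union> (B - I)) (compl_rel F) (card (I \<inter> A))"
      proof (intro less.hyps)
        fix J assume J: "J \<subseteq> (I \<inter> A) \<union> (B - I)" "indep F J"
        have "indep F (J \<union> (I \<inter> B))"
          unfolding indep_def
        proof (intro ballI)
          fix p q assume "p \<in> J \<union> (I \<inter> B)" "q \<in> J \<union> (I \<inter> B)"
          then show "\<not> F p q"
            using J I(2) ind(2) unfolding indep_def by blast
        qed
        then have "card (J \<union> (I \<inter> B)) \<le> w" using J I by (intro bound) auto
        moreover have "card (J \<union> (I \<inter> B)) = card J + card (I \<inter> B)"
          using J disj fin cI finite_subset[OF J(1)] by (intro card_Un_disjoint) auto
        ultimately show "card J \<le> card (I \<inter> A)" using cI cw by linarith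
      qed (use fin disj ind cI in \<open>auto simp: indep_def\<close>)
      show ?thesis
        using colourable_Un[OF c1 c2] cI cw by (elim colourable_mono) auto
    qed
  qed
qed

lemma clique_cover_if_2_colourable:
  assumes sym: "\<And>x y. F x y \<Longrightarrow> F y x" and irr: "\<And>x. \<not> F x x"
    and "finite X" "colourable X F 2"
    and bound: "\<And>I. I \<subseteq> X \<Longrightarrow> indep F I \<Longrightarrow> card I \<le> w"
  shows "colourable X (compl_rel F) w"
proof -
  obtain c where c: "proper_colouring X F 2 c" using assms by (auto simp: colourable_def)
  let ?A = "{x \<in> X. c x = 0}" and ?B = "{x \<in> X. c x = 1}"
  have X: "X = ?A \<union> ?B"
    using c by (auto simp: proper_colouring_def less_2_cases_iff)
  have "indep F ?A" "indep F ?B"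
    using c by (force simp: proper_colouring_def indep_def)+
  then have "colourable (?A \<union> ?B) (compl_rel F) w"
    using bound X assms(3) by (intro bipartite_clique_cover[OF sym irr]) auto
  then show ?thesis using X by simp
qed

lemma clique_cover_2_independent:
  assumes "\<And>x y. F x y \<Longrightarrow> F y x" "\<And>x. \<not> F x x" "finite X" "finite Y" "indep F X" "indep F Y"
    and "\<And>I. I \<subseteq> X \<union> Y \<Longrightarrow> indep F I \<Longrightarrow> card I \<le> w"
  shows "colourable (X \<union> Y) (compl_rel F) w"
proof (rule clique_cover_if_2_colourable)
  have "colourable (X \<union> Y) F (1 + 1)"
    using assms by (intro colourable_Un colourable_independent) (auto simp: indep_def)
  then show "colourable (X \<union> Y) F 2" by (simp add: numeral_2_eq_2)
qed (use assms in auto)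

section \<open>Arithmetic for the final count\<close>

text \<open>For \<open>a \<le> 4\<close> the bounds by \<open>a\<close> and \<open>2 * a\<close>
  give 9a - 8; for \<open>a \<ge> 7\<close> the bounds by 5 and \<open>a + 3\<close> give 4a + 19.
  At \<open>a = 5\<close> and \<open>a = 6\<close> such sums exceed 7a by 2 and 1, and the two
  disjunctions make up for it.\<close>

lemma vertex_count_arith:
  fixes a :: nat
  assumes "n \<le> g1 + g2 + g3 + A + B + m" "m + 2 \<le> 2 * a"
    and "g1 \<le> 5" "g2 \<le> 5" "g3 \<le> 5" "g1 \<le> a" "g2 \<le> a" "g3 \<le> a"
    and "A \<le> a + 3" "A + 3 \<le> 2 * a" "A + 4 \<le> 2 * a \<or> g1 + g2 \<le> 7"
    and "B \<le> a + 3" "B + 3 \<le> 2 * a" "B + 4 \<le> 2 * a \<or> g2 + g3 \<le> 7"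
  shows "n \<le> 7 * a"
proof -
  consider "a \<le> 4" | "a = 5" | "a = 6" | "a \<ge> 7" by linarith
  then show ?thesis using assms by cases auto
qed

text \<open>Splits off two vertices, each to be absorbed into a matching, so that at most two remain
  to be covered by single cliques. If \<open>P\<close> has one or two elements, \<open>p = q\<close>
  and \<open>R = P\<close> will do.\<close>

lemma card_le_4_cases:
  assumes "finite P" "card P \<le> 4"
  obtains p q R where "P \<subseteq> {p, q} \<union> R" "R \<subseteq> P" "card R \<le> 2" "P \<noteq> {} \<longrightarrow> p \<in> P \<and> q \<in> P"
proof (cases "card P \<le> 2")
  case True
  show ?thesis
  proof (cases "P = {}")
    case False
    then obtain p where "p \<in> P" by blast
    with True show ?thesis by (intro that[of p p P]) auto
  qed (use that in auto)
next
  case False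
  then obtain T where T: "T \<subseteq> P" "card T = 2"
    using obtain_subset_with_card_n[of 2 P] by (metis nat_le_linear)
  then obtain p q where pq: "T = {p, q}" "p \<noteq> q" by (meson card_2_iff)
  have "card (P - T) \<le> 2"
    using T assms card_Diff_subset[of T P] finite_subset by fastforce
  then show ?thesis using pq T by (intro that[of p q "P - T"]) auto
qed

section \<open>Edges anticomplete to a triangle\<close>

text \<open>\<open>F\<close> stands for adjacency in the complement of the given graph. The premises
  force distinct vertices: in \<open>P3P2_free\<close>, for instance, \<open>a = d\<close> would
  turn \<open>F d e\<close> into \<open>F a e\<close>.\<close>

locale K4_P3P2_free =
  fixes F :: "'a \<Rightarrow> 'a \<Rightarrow> bool" and V :: "'a set"
  assumes fin: "finite V"
    and sym: "F x y \<Longrightarrow> F y x"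
    and irr: "\<not> F x x"
    and K4_free: "\<lbrakk>F a b; F a c; F a d; F b c; F b d; F c d\<rbrakk> \<Longrightarrow> False"
    and P3P2_free: "\<lbrakk>F a b; F b c; a \<noteq> c; \<not> F a c; F d e; \<not> F a d; \<not> F a e; \<not> F b d; \<not> F b e;
      \<not> F c d; \<not> F c e\<rbrakk> \<Longrightarrow> False"
begin

lemma common_neighbours_colourable:
  assumes "F a b"
  shows "colourable {x \<in> V. F a x \<and> F b x} F 1"
  using assms K4_free by (intro colourable_independent) blast

text \<open>The ends \<open>u\<close>, \<open>v\<close> are included because they miss a triangle
  anticomplete to \<open>uv\<close> and so escape the argument that places the vertices adjacent to
  exactly one of them.\<close>

definition nonnbrs :: "'a \<Rightarrow> 'a \<Rightarrow> 'a set" where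
  "nonnbrs u v = {x \<in> V. x = u \<or> x = v \<or> \<not> F u x \<and> \<not> F v x}"

lemma nonnbrs_P3_free:
  assumes "F u v" "x \<in> nonnbrs u v" "y \<in> nonnbrs u v" "z \<in> nonnbrs u v"
    "F x y" "F y z" "x \<noteq> z"
  shows "F x z"
proof (rule ccontr)
  assume nxz: "\<not> F x z"
  have "(x = u \<or> x = v \<or> \<not> F u x \<and> \<not> F v x)" "(y = u \<or> y = v \<or> \<not> F u y \<and> \<not> F v y)"
    "(z = u \<or> z = v \<or> \<not> F u z \<and> \<not> F v z)"
    using assms by (auto simp: nonnbrs_def)
  \<comment> \<open>Within this set \<open>u\<close> and \<open>v\<close> are adjacent only to each
    other, so a path on three vertices avoids both.\<close>
  then have "\<not> F u x \<and> \<not> F v x" "\<not> F u y \<and> \<not> F v y" "\<not> F u z \<and> \<not> F v z"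
    using assms nxz irr sym by metis+
  then show False
    using P3P2_free[of x y z u v] nxz assms sym by blast
qed

text \<open>The components are cliques on at most three vertices, so all degrees are at most
  2.\<close>

lemma nonnbrs_colourable_3:
  assumes "F u v"
  shows "colourable (nonnbrs u v) F 3"
proof -
  have fX: "finite (nonnbrs u v)" using fin by (simp add: nonnbrs_def)
  have "card {y \<in> nonnbrs u v. F x y} \<le> 2" if x: "x \<in> nonnbrs u v" for x
  proof (rule card_le_2I)
    fix p q r
    assume pqr: "p \<in> {y \<in> nonnbrs u v. F x y}" "q \<in> {y \<in> nonnbrs u v. F x y}"
      "r \<in> {y \<in> nonnbrs u v. F x y}" "p \<noteq> q" "p \<noteq> r" "q \<noteq> r"
    have "F y z" if "y \<in> nonnbrs u v" "z \<in> nonnbrs u v" "F x y" "F x z" "y \<noteq> z" for y z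
      using nonnbrs_P3_free[OF assms that(1) x that(2)] that sym by blast
    then have "F p q" "F p r" "F q r" using pqr by auto
    then show False using K4_free[of x p q r] pqr by blast
  qed (use fX in auto)
  then show ?thesis
    using colourable_bounded_degree[of "nonnbrs u v" F 2] fX sym irr by (simp add: numeral_3_eq_3)
qed

lemma colourable_7_if_K3_K2:
  assumes uv: "F u v" and abc: "F a b" "F a c" "F b c"
    and anti: "\<not> F u a" "\<not> F u b" "\<not> F u c" "\<not> F v a" "\<not> F v b" "\<not> F v c"
  shows "colourable V F 7"
proof -
  let ?N = "\<lambda>p q. {x \<in> V. F p x \<and> F q x}"
  \<comment> \<open>\<open>s - r - x\<close> is an induced path whose vertices \<open>s\<close> and
    \<open>r\<close> miss the edge \<open>pq\<close>, so \<open>x\<close> must meet it. Over the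
    three edges of the triangle this makes \<open>x\<close> adjacent to two of its vertices.\<close>
  have hit: "F p x \<or> F q x"
    if "F r s" "F r x" "\<not> F s x" "x \<noteq> s" "F p q" "\<not> F r p" "\<not> F r q" "\<not> F s p" "\<not> F s q"
    for p q r s x
    using P3P2_free[of s r x p q] that sym by blast
  have "V \<subseteq> nonnbrs u v \<union> ?N u v \<union> ?N a b \<union> ?N a c \<union> ?N b c"
  proof
    fix x assume x: "x \<in> V"
    show "x \<in> nonnbrs u v \<union> ?N u v \<union> ?N a b \<union> ?N a c \<union> ?N b c"
    proof (cases "x \<in> nonnbrs u v \<or> F u x \<and> F v x")
      case False
      then consider "F u x" "\<not> F v x" "x \<noteq> v" | "F v x" "\<not> F u x" "x \<noteq> u"
        using x by (auto simp: nonnbrs_def)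
      then have "F a x \<or> F b x" "F a x \<or> F c x" "F b x \<or> F c x"
        using hit[of u v x] hit[of v u x] uv sym abc anti by metis+
      then show ?thesis using x by blast
    qed (use x in auto)
  qed
  moreover have "colourable (nonnbrs u v \<union> ?N u v \<union> ?N a b \<union> ?N a c \<union> ?N b c) F (3 + 1 + 1 + 1 + 1)"
    using assms by (intro colourable_Un nonnbrs_colourable_3 common_neighbours_colourable)
  ultimately show ?thesis using colourable_mono by fastforce
qed

end

section \<open>Graphs without an edge anticomplete to a triangle\<close>

locale K4_P3P2_K3K2_free = K4_P3P2_free +
  fixes a :: nat
  assumes K3K2_free: "\<lbrakk>F u v; F p q; F p r; F q r; \<not> F u p; \<not> F u q; \<not> F u r; \<not> F v p; \<not> F v q;
    \<not> F v r\<rbrakk> \<Longrightarrow> False"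
    and indep_card: "\<lbrakk>I \<subseteq> V; indep F I\<rbrakk> \<Longrightarrow> card I \<le> a"
begin

text \<open>Both cases for \<open>p\<close>, \<open>r\<close> are excluded: nonadjacent, they give
  P3 \<union> P2; adjacent, a triangle anticomplete to \<open>de\<close>.\<close>

lemma triple_edge_free:
  assumes "F p q" "F q r" "p \<noteq> r" "F d e" "\<not> F p d" "\<not> F p e" "\<not> F q d" "\<not> F q e"
    "\<not> F r d" "\<not> F r e"
  shows False
  using assms P3P2_free[of p q r d e] K3K2_free[of d e p q r] sym by blast

text \<open>The clique components now have at most two vertices, since a triangle among them would
  be anticomplete to \<open>uv\<close>.\<close>

lemma nonnbrs_colourable_2:
  assumes "F u v"
  shows "colourable (nonnbrs u v) F 2"
proof -
  have fX: "finite (nonnbrs u v)" using fin by (simp add: nonnbrs_def)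
  have "card {y \<in> nonnbrs u v. F x y} \<le> Suc 0" if x: "x \<in> nonnbrs u v" for x
  proof -
    have "p = q" if pq: "p \<in> nonnbrs u v" "q \<in> nonnbrs u v" "F x p" "F x q" for p q
    proof (rule ccontr)
      assume "p \<noteq> q"
      have "F p q" using nonnbrs_P3_free[OF assms pq(1) x pq(2)] pq \<open>p \<noteq> q\<close> sym by blast
      have "x = u \<or> x = v \<or> \<not> F u x \<and> \<not> F v x" "p = u \<or> p = v \<or> \<not> F u p \<and> \<not> F v p"
        "q = u \<or> q = v \<or> \<not> F u q \<and> \<not> F v q"
        using pq x by (auto simp: nonnbrs_def)
      then have "\<not> F u x \<and> \<not> F v x" "\<not> F u p \<and> \<not> F v p" "\<not> F u q \<and> \<not> F v q"
        using pq \<open>F p q\<close> assms irr sym by metis+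
      then show False using K3K2_free[of u v x p q] pq \<open>F p q\<close> assms by blast
    qed
    then show ?thesis using fX by (subst card_le_Suc0_iff_eq) auto
  qed
  then show ?thesis
    using colourable_bounded_degree[of "nonnbrs u v" F "Suc 0"] fX sym irr by (simp add: numeral_2_eq_2)
qed

text \<open>Given \<open>x\<close> with two neighbours \<open>y\<close>, \<open>z\<close>, one
  colour class is \<open>D\<close>, that is \<open>x\<close> with the vertices at distance two, and
  the other is the rest. An edge inside \<open>D\<close> closes a walk of length five. An edge in
  the rest makes a triangle with \<open>x\<close>, or has an end at distance two, or makes P3
  \<union> P2 with \<open>y - x - z\<close>. Without such an \<open>x\<close> all degrees are at
  most 1.\<close>

lemma bipartite_if_no_short_odd_cycle:
  assumes XV: "X \<subseteq> V"
    and K3: "\<And>x y z. \<lbrakk>x \<in> X; y \<in> X; z \<in> X; F x y; F y z; F x z\<rbrakk> \<Longrightarrow> False"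
    and C5: "\<And>a b c d e. \<lbrakk>a \<in> X; b \<in> X; c \<in> X; d \<in> X; e \<in> X; F a b; F b c; F c d; F d e; F e a\<rbrakk>
      \<Longrightarrow> False"
  shows "colourable X F 2"
proof (cases "\<exists>x y z. x \<in> X \<and> y \<in> X \<and> z \<in> X \<and> F x y \<and> F x z \<and> y \<noteq> z")
  case True
  then obtain x y z where xyz: "x \<in> X" "y \<in> X" "z \<in> X" "F x y" "F x z" "y \<noteq> z" by blast
  have nyz: "\<not> F y z" using K3 xyz by blast
  define D where "D = {s \<in> X. s = x \<or> \<not> F x s \<and> (\<exists>p \<in> X. F x p \<and> F p s)}"
  have "\<not> F s t" if st_D: "s \<in> D" "t \<in> D" for s t
  proof
    assume st: "F s t"
    show False
    proof (cases "s = x \<or> t = x")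
      case True
      then show ?thesis using st_D st irr sym by (auto simp: D_def)
    next
      case False
      then obtain p q where "p \<in> X" "F x p" "F p s" "q \<in> X" "F x q" "F q t"
        using st_D by (auto simp: D_def)
      then show ?thesis
        using C5[of x p s t q] st_D st xyz sym by (auto simp: D_def)
    qed
  qed
  moreover have "\<not> F s t" if "s \<in> X - D" "t \<in> X - D" for s t
  proof
    assume st: "F s t"
    have nx: "s \<noteq> x" "t \<noteq> x" using that xyz by (auto simp: D_def)
    have *: "F x r \<or> (\<forall>p\<in>X. F x p \<longrightarrow> \<not> F p r)" if "r \<in> X - D" for r
      using that by (auto simp: D_def)
    show False
    proof (cases "F x s \<or> F x t")
      case True
      then show ?thesis using *[of s] *[of t] st that K3[of x s t] xyz sym by blast
    next
      case False
      then have "\<not> F y s" "\<not> F z s" "\<not> F y t" "\<not> F z t"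
        using *[of s] *[of t] that xyz by blast+
      then show ?thesis
        using P3P2_free[of y x z s t] xyz nyz st False sym by blast
    qed
  qed
  ultimately have "colourable (D \<union> (X - D)) F (1 + 1)"
    by (intro colourable_Un colourable_independent) auto
  then show ?thesis using colourable_mono by (metis Un_Diff_cancel Un_upper2 nat_1_add_1 order_refl)
next
  case False
  have fX: "finite X" using XV fin finite_subset by blast
  have "card {y \<in> X. F x y} \<le> Suc 0" if "x \<in> X" for x
    using fX False that by (subst card_le_Suc0_iff_eq) auto
  then show ?thesis
    using colourable_bounded_degree[of X F "Suc 0"] fX sym irr by (simp add: numeral_2_eq_2)
qed

lemma nonnbrs_matching:
  assumes "F d e" "F p q" "F q r" "\<not> F d p" "\<not> F e p" "\<not> F d q" "\<not> F e q" "\<not> F d r" "\<not> F e r"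
  shows "p = r"
  using triple_edge_free[of p q r d e] assms sym by blast

section \<open>Five-cycles in the difference of two neighbourhoods\<close>

text \<open>The \<open>wi\<close> are automatically distinct: a closed walk of length five with a
  repetition contains a triangle, which together with \<open>z\<close> would be a K4.\<close>

definition arrow :: "'a \<Rightarrow> 'a \<Rightarrow> bool" where
  "arrow z z' \<longleftrightarrow> (\<exists>w1 w2 w3 w4 w5. {w1, w2, w3, w4, w5} \<subseteq> {x \<in> V. F z x \<and> \<not> F z' x} \<and>
    F w1 w2 \<and> F w2 w3 \<and> F w3 w4 \<and> F w4 w5 \<and> F w5 w1)"

abbreviation nbrs2 :: "'a \<Rightarrow> 'a \<Rightarrow> 'a set" where
  "nbrs2 u v \<equiv> {x \<in> V. F u x \<and> F v x}"

lemma colourable_2_if_not_arrow: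
  assumes "\<not> arrow z z'"
  shows "colourable {x \<in> V. F z x \<and> \<not> F z' x} F 2"
proof (rule bipartite_if_no_short_odd_cycle)
  fix p q r assume "p \<in> {x \<in> V. F z x \<and> \<not> F z' x}" "q \<in> {x \<in> V. F z x \<and> \<not> F z' x}"
    "r \<in> {x \<in> V. F z x \<and> \<not> F z' x}" "F p q" "F q r" "F p r"
  then show False using K4_free[of z p q r] by blast
next
  fix p q r s t
  assume "p \<in> {x \<in> V. F z x \<and> \<not> F z' x}" "q \<in> {x \<in> V. F z x \<and> \<not> F z' x}"
    "r \<in> {x \<in> V. F z x \<and> \<not> F z' x}" "s \<in> {x \<in> V. F z x \<and> \<not> F z' x}"
    "t \<in> {x \<in> V. F z x \<and> \<not> F z' x}" "F p q" "F q r" "F r s" "F s t" "F t p"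
  then have "arrow z z'"
    unfolding arrow_def
    by (intro exI[of _ p] exI[of _ q] exI[of _ r] exI[of _ s] exI[of _ t]) auto
  then show False using assms by blast
qed auto

lemma colourable_7_if_no_arrow:
  assumes "F z z'" "\<not> arrow z z'" "\<not> arrow z' z"
  shows "colourable V F 7"
proof -
  have "colourable (nonnbrs z z' \<union> nbrs2 z z' \<union> {x \<in> V. F z x \<and> \<not> F z' x} \<union>
      {x \<in> V. F z' x \<and> \<not> F z x}) F (2 + 1 + 2 + 2)"
    using assms by (intro colourable_Un nonnbrs_colourable_2 common_neighbours_colourable
        colourable_2_if_not_arrow)
  then show ?thesis by (elim colourable_mono) (auto simp: nonnbrs_def)
qed

text \<open>Each common neighbour of \<open>z\<close> and \<open>z'\<close> misses an edge of the 5-cycle, and no edge is missed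
  twice.\<close>

lemma codegree_le_5:
  assumes zz: "F z z'" and ar: "arrow z z'"
  shows "card (nbrs2 z z') \<le> 5"
proof -
  obtain w1 w2 w3 w4 w5 where
    w: "\<And>x. x \<in> {w1, w2, w3, w4, w5} \<Longrightarrow> F z x \<and> \<not> F z' x"
    and c: "F w1 w2" "F w2 w3" "F w3 w4" "F w4 w5" "F w5 w1"
    using ar unfolding arrow_def by (metis (mono_tags, lifting) mem_Collect_eq subsetD)
  define M where "M p q = {x \<in> nbrs2 z z'. \<not> F x p \<and> \<not> F x q}" for p q
  have M1: "card (M p q) \<le> 1" if "F p q" "\<not> F z' p" "\<not> F z' q" for p q
  proof -
    \<comment> \<open>Otherwise \<open>x - z' - y\<close> is a path or triangle anticomplete to the
      edge \<open>pq\<close>.\<close>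
    have "x = y" if "x \<in> M p q" "y \<in> M p q" for x y
      using triple_edge_free[of x z' y p q] that \<open>F p q\<close> \<open>\<not> F z' p\<close> \<open>\<not> F z' q\<close> sym
      by (auto simp: M_def)
    moreover have "finite (M p q)" using fin by (auto simp: M_def)
    ultimately show ?thesis by (simp add: card_le_Suc0_iff_eq)
  qed
  have ne: "F x p \<Longrightarrow> \<not> F x q"
    if "x \<in> nbrs2 z z'" "F p q" "p \<in> {w1, w2, w3, w4, w5}" "q \<in> {w1, w2, w3, w4, w5}" for x p q
    using K4_free[of z x p q] that w[of p] w[of q] by blast
  have "nbrs2 z z' \<subseteq> M w1 w2 \<union> M w2 w3 \<union> M w3 w4 \<union> M w4 w5 \<union> M w5 w1"
  proof
    fix x assume x: "x \<in> nbrs2 z z'"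
    \<comment> \<open>As five is odd, the edges of the cycle cannot all have exactly one end
      adjacent to \<open>x\<close>; none has two, so some edge has none.\<close>
    have "\<not> (F x w1 \<and> F x w2)" "\<not> (F x w2 \<and> F x w3)" "\<not> (F x w3 \<and> F x w4)" "\<not> (F x w4 \<and> F x w5)"
      "\<not> (F x w5 \<and> F x w1)"
      using ne[OF x c(1)] ne[OF x c(2)] ne[OF x c(3)] ne[OF x c(4)] ne[OF x c(5)] by auto
    then show "x \<in> M w1 w2 \<union> M w2 w3 \<union> M w3 w4 \<union> M w4 w5 \<union> M w5 w1"
      using x unfolding M_def by blast
  qed
  then have "card (nbrs2 z z') \<le> card (M w1 w2 \<union> M w2 w3 \<union> M w3 w4 \<union> M w4 w5 \<union> M w5 w1)"
    using fin by (intro card_mono) (auto simp: M_def)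
  also have "\<dots> \<le> card (M w1 w2) + card (M w2 w3) + card (M w3 w4) + card (M w4 w5) + card (M w5 w1)"
    by (meson add_mono_thms_linordered_semiring(3) card_Un_le order_trans)
  also have "\<dots> \<le> 1 + 1 + 1 + 1 + 1"
    using M1 w c by (intro add_mono) auto
  finally show ?thesis by simp
qed

text \<open>\<open>X\<close> induces a matching. If \<open>p\<close> forms a triangle with a
  matching edge \<open>qr\<close>, this triangle is spent as one clique, and \<open>q\<close>
  extends every independent set of the rest. Otherwise the graph stays bipartite with
  \<open>p\<close> added, and Koenig's theorem applies.\<close>

lemma absorb_clique_cover:
  assumes X: "X \<subseteq> V" "p \<in> V"
    and deg: "\<And>x y z. \<lbrakk>x \<in> X; y \<in> X; z \<in> X; F x y; F y z\<rbrakk> \<Longrightarrow> x = z"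
    and bound: "\<And>I. I \<subseteq> insert p X \<Longrightarrow> indep F I \<Longrightarrow> card I \<le> t"
  shows "colourable (insert p X) (compl_rel F) t"
proof (cases "\<exists>q\<in>X. \<exists>r\<in>X. F q r \<and> F p q \<and> F p r")
  case True
  then obtain q r where qr: "q \<in> X" "r \<in> X" "F q r" "F p q" "F p r" by blast
  have t0: "0 < t" using bound[of "{q}"] qr irr by (auto simp: indep_def)
  have fX: "finite X" using X fin finite_subset by blast
  let ?Y = "X - {p, q, r}"
  have "colourable ?Y (compl_rel F) (t - 1)"
  proof (rule clique_cover_if_2_colourable[OF sym irr])
    show "colourable ?Y F 2"
    proof (rule bipartite_if_no_short_odd_cycle)
      fix x y z assume "x \<in> ?Y" "y \<in> ?Y" "z \<in> ?Y" "F x y" "F y z" "F x z"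
      then show False using deg[of x y z] irr by auto
    next
      fix x y z u v assume "x \<in> ?Y" "y \<in> ?Y" "z \<in> ?Y" "u \<in> ?Y" "v \<in> ?Y" "F x y" "F y z" "F z u"
        "F u v" "F v x"
      then show False using deg[of x y z] deg[of z u v] irr by auto
    qed (use X in auto)
    fix I assume I: "I \<subseteq> ?Y" "indep F I"
    have "\<not> F q i" "\<not> F i q" if "i \<in> I" for i
      using deg[of r q i] qr I that sym by blast+
    then have "indep F (insert q I)" using I irr unfolding indep_def by blast
    then have "card (insert q I) \<le> t" using I qr by (intro bound) auto
    moreover have "card (insert q I) = Suc (card I)"
      using I fX finite_subset[of I X] by (intro card_insert_disjoint) auto
    ultimately show "card I \<le> t - 1" by simp
  qed (use fX in auto)
  moreover have "colourable {p, q, r} (compl_rel F) 1"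
    using qr sym by (intro colourable_independent) auto
  ultimately have "colourable (?Y \<union> {p, q, r}) (compl_rel F) (t - 1 + 1)"
    by (rule colourable_Un)
  then show ?thesis using t0 by (elim colourable_mono) auto
next
  case False
  show ?thesis
  proof (rule clique_cover_if_2_colourable[OF sym irr _ _ bound])
    have K3: False if "x \<in> insert p X" "y \<in> insert p X" "z \<in> insert p X" "F x y" "F y z" "F x z"
      for x y z
      using that False deg irr sym by (metis insertE)
    show "colourable (insert p X) F 2"
    proof (rule bipartite_if_no_short_odd_cycle)
      fix x y z assume "x \<in> insert p X" "y \<in> insert p X" "z \<in> insert p X" "F x y" "F y z" "F x z"
      then show False by (rule K3)
    next
      fix v w x y z assume H: "v \<in> insert p X" "w \<in> insert p X" "x \<in> insert p X" "y \<in> insert p X"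
        "z \<in> insert p X" "F v w" "F w x" "F x y" "F y z" "F z v"
      have ne: "v \<noteq> x" "w \<noteq> y" "x \<noteq> z" "y \<noteq> v" "z \<noteq> w"
        using H K3 sym by metis+
      \<comment> \<open>The five vertices are distinct, so \<open>p\<close> is at most one of them
        and three consecutive ones lie in \<open>X\<close>, where \<open>deg\<close> would identify
        the outer two.\<close>
      consider "{v, w, x} \<subseteq> X" | "{w, x, y} \<subseteq> X" | "{x, y, z} \<subseteq> X" | "{y, z, v} \<subseteq> X"
        | "{z, v, w} \<subseteq> X"
        using H ne irr by auto
      then show False
        using H ne deg by cases auto
    qed (use X in auto)
  qed (use X fin finite_subset in auto)
qed

lemma indep_insertI:
  assumes "indep F I" "\<And>y. y \<in> I \<Longrightarrow> \<not> F x y"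
  shows "indep F (insert x I)"
  using assms irr sym unfolding indep_def by (metis insert_iff)

section \<open>Vertices adjacent to exactly one vertex of a triangle\<close>

text \<open>In use, \<open>u\<close>, \<open>b\<close>, \<open>x\<close> form a triangle. Being
  common non-neighbours of the edge \<open>bx\<close>, the vertices of \<open>side u b x\<close>
  induce a matching, and \<open>side_matched\<close> collects those it covers.\<close>

definition side :: "'a \<Rightarrow> 'a \<Rightarrow> 'a \<Rightarrow> 'a set" where
  "side u b x = {y \<in> V. F u y \<and> \<not> F b y \<and> \<not> F x y}"

definition side_matched :: "'a \<Rightarrow> 'a \<Rightarrow> 'a \<Rightarrow> 'a set" where
  "side_matched u b x = {y \<in> side u b x. \<exists>q \<in> side u b x. F y q}"

lemma side_commute: "side u b x = side u x b" "side_matched u b x = side_matched u x b"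
  by (auto simp: side_def side_matched_def)

lemma finite_side: "finite (side u b x)" "finite (side_matched u b x)"
  using fin by (auto simp: side_def side_matched_def)

lemma side_matching:
  assumes "F b x" "p \<in> side u b x" "q \<in> side u b x" "r \<in> side u b x" "F p q" "F q r"
  shows "p = r"
  using nonnbrs_matching[of b x p q r] assms by (auto simp: side_def)

context
  fixes u b x s
  assumes tri: "F u b" "F u x" "F b x" "u \<in> V" "b \<in> V" "x \<in> V"
    and s: "s \<in> V" "F u s" "F b s" "s \<noteq> x"
begin

lemma nxs: "\<not> F x s"
  using K4_free[of u b x s] tri s by blast

text \<open>So \<open>s\<close> selects one end of every edge inside \<open>side u b x\<close>.\<close>

lemma side_hit:
  assumes "p \<in> side u b x" "q \<in> side u b x" "F p q"
  shows "F s p \<longleftrightarrow> \<not> F s q"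
  \<comment> \<open>If \<open>s\<close> misses both ends, \<open>s - b - x\<close> is anticomplete
    to \<open>pq\<close>; if it hits both, \<open>u\<close>, \<open>s\<close>, \<open>p\<close>,
    \<open>q\<close> form a K4.\<close>
  using triple_edge_free[of s b x p q] K4_free[of u s p q] assms tri s sym
  by (auto simp: side_def)

abbreviation missed where "missed \<equiv> {y \<in> side_matched u b x. \<not> F s y}"
abbreviation hit where "hit \<equiv> {y \<in> side_matched u b x. F s y}"

text \<open>Passing to the matching partner is an involution, and it swaps the two sets by
  \<open>side_hit\<close>.\<close>

lemma side_matched_bij: "\<exists>f. bij_betw f missed hit"
proof -
  define f where "f p = (SOME q. q \<in> side u b x \<and> F p q)" for p
  have f: "f p \<in> side u b x" "F p (f p)" if p: "p \<in> side_matched u b x" for p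
  proof -
    have "\<exists>q. q \<in> side u b x \<and> F p q" using p by (auto simp: side_matched_def)
    then have "f p \<in> side u b x \<and> F p (f p)" unfolding f_def by (rule someI_ex)
    then show "f p \<in> side u b x" "F p (f p)" by blast+
  qed
  have fm: "f p \<in> side_matched u b x" "f (f p) = p" if p: "p \<in> side_matched u b x" for p
  proof -
    have ps: "p \<in> side u b x" using p by (simp add: side_matched_def)
    have "F (f p) p" using f(2)[OF p] sym by blast
    then show fp: "f p \<in> side_matched u b x"
      using f(1)[OF p] ps unfolding side_matched_def by blast
    show "f (f p) = p"
      using side_matching[OF tri(3) ps f(1)[OF p] f(1)[OF fp] f(2)[OF p] f(2)[OF fp]] by simp
  qed
  have h: "F s p \<longleftrightarrow> \<not> F s (f p)" if p: "p \<in> side_matched u b x" for p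
  proof -
    have "p \<in> side u b x" using p by (simp add: side_matched_def)
    then show ?thesis using side_hit f[OF p] by blast
  qed
  have "bij_betw f missed hit"
    by (rule bij_betw_byWitness[where f' = f]) (use fm h in blast)+
  then show ?thesis by blast
qed

lemma card_hit: "card hit = card missed"
proof -
  obtain f where "bij_betw f missed hit" using side_matched_bij by blast
  then show ?thesis by (simp only: bij_betw_same_card)
qed

lemma card_side_matched: "card (side_matched u b x) = 2 * card missed"
proof -
  have "side_matched u b x = missed \<union> hit" by auto
  moreover have "card (missed \<union> hit) = card missed + card hit"
    using finite_side by (intro card_Un_disjoint) auto
  ultimately show ?thesis using card_hit by simp
qed

lemma indep_missed: "indep F (insert x (insert s missed))"
proof -
  have "\<not> F p q" if "p \<in> missed" "q \<in> missed" for p q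
    using side_hit[of p q] that by (auto simp: side_matched_def)
  moreover have "\<not> F x p" "\<not> F p x" "\<not> F s p" "\<not> F p s" if "p \<in> missed" for p
    using that sym by (auto simp: side_matched_def side_def)
  ultimately show ?thesis using nxs sym irr unfolding indep_def by blast
qed

lemma not_in_side: "x \<notin> side u b x" "s \<notin> side u b x" "b \<notin> side u b x"
  using tri s sym by (auto simp: side_def)

lemma side_sub: "side u b x \<subseteq> V" "side_matched u b x \<subseteq> side u b x" "missed \<subseteq> V"
  by (auto simp: side_def side_matched_def)

lemma not_in_missed: "finite missed" "finite hit" "x \<notin> missed" "s \<notin> missed" "b \<notin> hit"
  using not_in_side finite_side by (auto simp: side_matched_def)

lemma card_missed_alpha: "card missed + 2 \<le> a"
proof -
  have "card (insert x (insert s missed)) \<le> a"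
    using indep_missed side_sub tri s by (intro indep_card) auto
  moreover have "card (insert x (insert s missed)) = card missed + 2"
    using not_in_missed s(4) by (simp del: mem_Collect_eq)
  ultimately show ?thesis by simp
qed

text \<open>\<open>b\<close> and all of \<open>hit\<close>, which is as large as
  \<open>missed\<close>, are common neighbours of \<open>u\<close> and \<open>s\<close>.\<close>

lemma card_missed_codegree: "card missed + 1 \<le> card (nbrs2 u s)"
proof -
  have "card (insert b hit) \<le> card (nbrs2 u s)"
    using fin tri s side_sub sym by (intro card_mono) (auto simp: side_matched_def side_def)
  moreover have "card (insert b hit) = card hit + 1"
    using not_in_missed by (simp del: mem_Collect_eq)
  ultimately show ?thesis using card_hit by simp
qed

text \<open>Removing \<open>missed\<close> takes one end off every matching edge.\<close>

lemma indep_side_diff: "indep F (side u b x - missed)"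
  unfolding indep_def
proof (intro ballI notI)
  fix p q assume pq: "p \<in> side u b x - missed" "q \<in> side u b x - missed" "F p q"
  then have "p \<in> side_matched u b x" "q \<in> side_matched u b x"
    using sym by (auto simp: side_matched_def)
  then show False using side_hit[of p q] pq by blast
qed

lemma card_side_diff: "card (side u b x - missed) + 1 \<le> a"
proof -
  have "indep F (insert b (side u b x - missed))"
    by (rule indep_insertI[OF indep_side_diff]) (auto simp: side_def)
  then have "card (insert b (side u b x - missed)) \<le> a"
    using side_sub tri by (intro indep_card) auto
  then show ?thesis using not_in_side finite_side by simp
qed

lemma card_side: "card (side u b x) + 1 \<le> a + card missed"
proof -
  have sub: "missed \<subseteq> side u b x" using side_sub by blast
  then have "card missed \<le> card (side u b x)" using finite_side by (intro card_mono)
  moreover have "card (side u b x - missed) = card (side u b x) - card missed"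
    using sub not_in_missed by (intro card_Diff_subset)
  ultimately show ?thesis using card_side_diff by linarith
qed

text \<open>Here \<open>missed\<close> with \<open>x\<close> and \<open>s\<close> is already a
  maximum independent set; an unmatched \<open>z\<close> missing \<open>s\<close> would enlarge
  it.\<close>

lemma unmatched_adjacent:
  assumes "z \<in> side u b x - side_matched u b x" "card missed + 3 > a"
  shows "F s z"
proof (rule ccontr)
  assume n: "\<not> F s z"
  have z: "\<not> F z p" "\<not> F p z" if "p \<in> side u b x" for p
    using assms that sym by (auto simp: side_matched_def)
  have "\<not> F z x" using assms(1) sym by (auto simp: side_def)
  moreover have "\<not> F z s" using n sym by blast
  moreover have "\<not> F z p" if "p \<in> missed" for p using z(1) that side_sub by blast
  ultimately have "indep F (insert z (insert x (insert s missed)))"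
    by (intro indep_insertI[OF indep_missed]) blast
  then have "card (insert z (insert x (insert s missed))) \<le> a"
    using side_sub tri s assms by (intro indep_card) auto
  moreover have "z \<notin> missed" "z \<noteq> x" "z \<noteq> s" using assms not_in_side by auto
  then have "card (insert z (insert x (insert s missed))) = card missed + 3"
    using not_in_missed s(4) by (simp del: mem_Collect_eq)
  ultimately show False using assms by simp
qed

end

text \<open>The side has at most 2a - 3 vertices. In case of equality \<open>missed\<close> has a -
  2, so some \<open>z\<close> is unmatched, and it is adjacent to every common neighbour of
  \<open>u\<close>, \<open>b\<close> except \<open>x\<close> and of \<open>u\<close>,
  \<open>x\<close> except \<open>b\<close>. These are disjoint families of common neighbours of
  \<open>u\<close> and \<open>z\<close>, at most 5 in total.\<close>

lemma card_side_or_codegree: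
  assumes tri: "F u b" "F u x" "F b x" "u \<in> V" "b \<in> V" "x \<in> V"
    and s: "s \<in> V" "F u s" "F b s" "s \<noteq> x"
    and codeg: "\<And>p q. F p q \<Longrightarrow> card (nbrs2 p q) \<le> 5"
  shows "card (side u b x) + 4 \<le> 2 * a \<or> card (nbrs2 u b) + card (nbrs2 u x) \<le> 7"
proof (rule disjCI)
  assume "\<not> card (nbrs2 u b) + card (nbrs2 u x) \<le> 7"
  then have big: "card (nbrs2 u b) + card (nbrs2 u x) > 7" by simp
  let ?k = "card {y \<in> side_matched u b x. \<not> F s y}"
  show "card (side u b x) + 4 \<le> 2 * a"
  proof (rule ccontr)
    assume c: "\<not> ?thesis"
    have k: "card (side_matched u b x) = 2 * ?k" "?k + 2 \<le> a" "card (side u b x) + 1 \<le> a + ?k"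
      using card_side_matched[OF tri s] card_missed_alpha[OF tri s] card_side[OF tri s] by auto
    have "side_matched u b x \<noteq> side u b x" using c k by auto
    then obtain z where z: "z \<in> side u b x - side_matched u b x"
      using side_matched_def by blast
    have k3: "?k + 3 > a" using c k by linarith
    have adj: "F t z" if t: "t \<in> (nbrs2 u b - {x}) \<union> (nbrs2 u x - {b})" for t
      using t
    proof
      assume "t \<in> nbrs2 u b - {x}"
      then have t: "t \<in> V" "F u t" "F b t" "t \<noteq> x" by auto
      \<comment> \<open>The missed vertices are half of \<open>side_matched\<close> whichever common
        neighbour is used, so their number is the same for \<open>t\<close> as for
        \<open>s\<close>.\<close>
      have "card {y \<in> side_matched u b x. \<not> F t y} + 3 > a"
        using card_side_matched[OF tri t] k k3 by simp
      then show ?thesis using unmatched_adjacent[OF tri t z] by simp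
    next
      assume "t \<in> nbrs2 u x - {b}"
      then have t: "t \<in> V" "F u t" "F x t" "t \<noteq> b" by auto
      have tri': "F u x" "F u b" "F x b" "u \<in> V" "x \<in> V" "b \<in> V" using tri sym by auto
      have "card {y \<in> side_matched u x b. \<not> F t y} + 3 > a"
        using card_side_matched[OF tri' t] k k3 side_commute by simp
      then show ?thesis using unmatched_adjacent[OF tri' t, of z] z side_commute by simp
    qed
    have uz: "F u z" using z by (auto simp: side_def)
    have "card ((nbrs2 u b - {x}) \<union> (nbrs2 u x - {b})) \<le> card (nbrs2 u z)"
      using adj fin sym by (intro card_mono) auto
    moreover have "card ((nbrs2 u b - {x}) \<union> (nbrs2 u x - {b})) =
        card (nbrs2 u b - {x}) + card (nbrs2 u x - {b})"
      using fin K4_free[of u b x] tri by (intro card_Un_disjoint) auto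
    moreover have "card (nbrs2 u b - {x}) = card (nbrs2 u b) - 1"
      "card (nbrs2 u x - {b}) = card (nbrs2 u x) - 1"
      using tri sym fin by auto
    ultimately show False using codeg[OF uz] big by linarith
  qed
qed

section \<open>Both bounds from a triangle\<close>

text \<open>The set is 2-colourable, and \<open>u\<close> extends each colour class to a larger
  independent set.\<close>

lemma card_nonneighbours:
  assumes "F u x" "u \<in> V"
  shows "card {y \<in> V. \<not> F u y \<and> \<not> F x y} + 2 \<le> 2 * a"
proof -
  define M where "M = {y \<in> V. \<not> F u y \<and> \<not> F x y}"
  have M: "M \<subseteq> V" "u \<notin> M" "\<And>y. y \<in> M \<Longrightarrow> \<not> F u y" "finite M"
    using assms(1) sym[OF assms(1)] fin by (auto simp: M_def)
  have "colourable M F 2"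
    using nonnbrs_colourable_2[OF assms(1)]
    by (elim colourable_mono) (auto simp: nonnbrs_def M_def)
  then obtain c where c: "proper_colouring M F 2 c" by (auto simp: colourable_def)
  define C where "C i = {y \<in> M. c y = i}" for i
  have C: "card (C i) + 1 \<le> a" for i
  proof -
    have "indep F (C i)"
      unfolding indep_def
    proof (intro ballI notI)
      fix p q assume pq: "p \<in> C i" "q \<in> C i" "F p q"
      then have "c p \<noteq> c q" using c unfolding C_def proper_colouring_def by blast
      then show False using pq by (simp add: C_def)
    qed
    then have "indep F (insert u (C i))"
      by (rule indep_insertI) (use M in \<open>simp add: C_def\<close>)
    then have "card (insert u (C i)) \<le> a"
      using assms M by (intro indep_card) (auto simp: C_def)
    moreover have "card (insert u (C i)) = Suc (card (C i))"
      using M by (intro card_insert_disjoint) (auto simp: C_def)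
    ultimately show ?thesis by simp
  qed
  have "c y = 0 \<or> c y = 1" if "y \<in> M" for y
    using c that less_2_cases[of "c y"] by (simp add: proper_colouring_def)
  then have "M = C 0 \<union> C 1" unfolding C_def by blast
  then have "card M \<le> card (C 0) + card (C 1)"
    using card_Un_le[of "C 0" "C 1"] by simp
  then show ?thesis using C[of 0] C[of 1] unfolding M_def by linarith
qed

lemma codegree_indep:
  assumes "F p q" shows "indep F (nbrs2 p q)"
  unfolding indep_def
proof (intro ballI notI)
  fix y z assume "y \<in> nbrs2 p q" "z \<in> nbrs2 p q" "F y z"
  then show False using K4_free[of p q y z] assms by blast
qed

text \<open>Vertices adjacent to \<open>b\<close> alone, or to none of the three, count among the
  common non-neighbours of \<open>u\<close> and \<open>x\<close>, so only two sides occur;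
  \<open>s\<close> and \<open>t\<close> serve one side each.\<close>

lemma card_V_le:
  assumes tri: "F u b" "F u x" "F b x" "u \<in> V" "b \<in> V" "x \<in> V"
    and s: "s \<in> V" "F u s" "F b s" "s \<noteq> x"
    and t: "t \<in> V" "F x t" "F u t" "t \<noteq> b"
    and codeg: "\<And>p q. F p q \<Longrightarrow> card (nbrs2 p q) \<le> 5"
  shows "card V \<le> 7 * a"
proof (rule vertex_count_arith)
  have tri': "F x u" "F x b" "F u b" "x \<in> V" "u \<in> V" "b \<in> V" using tri sym by auto
  let ?M = "{y \<in> V. \<not> F u y \<and> \<not> F x y}"
  have "V \<subseteq> nbrs2 u b \<union> nbrs2 u x \<union> nbrs2 x b \<union> side u b x \<union> side x u b \<union> ?M"
    by (auto simp: side_def)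
  then have "card V \<le> card (nbrs2 u b \<union> nbrs2 u x \<union> nbrs2 x b \<union> side u b x \<union> side x u b \<union> ?M)"
    using fin finite_side by (intro card_mono) auto
  also have "\<dots> \<le> card (nbrs2 u b) + card (nbrs2 u x) + card (nbrs2 x b) + card (side u b x)
      + card (side x u b) + card ?M"
    by (meson add_mono_thms_linordered_semiring(3) card_Un_le order_trans)
  finally show "card V \<le> \<dots>" .
  show "card ?M + 2 \<le> 2 * a" using card_nonneighbours tri by blast
  show "card (nbrs2 u b) \<le> 5" "card (nbrs2 u x) \<le> 5" "card (nbrs2 x b) \<le> 5"
    using codeg tri' tri by auto
  show "card (nbrs2 u b) \<le> a" "card (nbrs2 u x) \<le> a" "card (nbrs2 x b) \<le> a"
    using codegree_indep tri' tri by (auto intro!: indep_card)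
  \<comment> \<open>At most 5 common neighbours of \<open>u\<close>, \<open>s\<close> and of
    \<open>x\<close>, \<open>t\<close> leave at most 4 missed vertices on either side.\<close>
  have "F u s" "F x t" using s t by auto
  then have "card {y \<in> side_matched u b x. \<not> F s y} \<le> 4"
    "card {y \<in> side_matched x u b. \<not> F t y} \<le> 4"
    using card_missed_codegree[OF tri s] card_missed_codegree[OF tri' t] codeg[of u s] codeg[of x t]
    by linarith+
  then show "card (side u b x) \<le> a + 3" "card (side u b x) + 3 \<le> 2 * a"
    "card (side x u b) \<le> a + 3" "card (side x u b) + 3 \<le> 2 * a"
    using card_side[OF tri s] card_side[OF tri' t] card_missed_alpha[OF tri s]
      card_missed_alpha[OF tri' t] by linarith+
  show "card (side u b x) + 4 \<le> 2 * a \<or> card (nbrs2 u b) + card (nbrs2 u x) \<le> 7"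
    using card_side_or_codegree[OF tri s] codeg by blast
  have "nbrs2 x u = nbrs2 u x" by auto
  then show "card (side x u b) + 4 \<le> 2 * a \<or> card (nbrs2 u x) + card (nbrs2 x b) \<le> 7"
    using card_side_or_codegree[OF tri' t] codeg by fastforce
qed

text \<open>The pairs \<open>N(u) \<inter> N(b)\<close>, \<open>N(u) \<inter> N(x)\<close> and \<open>side u b x - ?P\<close>, \<open>N(b) \<inter> N(x)\<close> of independent sets need
  \<open>a\<close> cliques each.  The two remaining matchings need only \<open>a - 1\<close> cliques each, even after adding one
  vertex of \<open>?P\<close> to either, which leaves at most two vertices of \<open>?P\<close>.\<close>

lemma clique_cover_V:
  assumes tri: "F u b" "F u x" "F b x" "u \<in> V" "b \<in> V" "x \<in> V"
    and s: "s \<in> V" "F u s" "F b s" "s \<noteq> x"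
    and codeg: "\<And>p q. F p q \<Longrightarrow> card (nbrs2 p q) \<le> 5"
  shows "colourable V (compl_rel F) (4 * a)"
proof -
  let ?P = "{y \<in> side_matched u b x. \<not> F s y}"
  let ?M = "{y \<in> V. \<not> F u y \<and> \<not> F x y}"
  have fP: "finite ?P" using finite_side by simp
  have Ps: "?P \<subseteq> side u b x" using side_sub[OF tri s] by blast
  have "card ?P \<le> 4" using card_missed_codegree[OF tri s] codeg[OF s(2)] by linarith
  with fP obtain p q R where PR: "?P \<subseteq> {p, q} \<union> R" "R \<subseteq> ?P" "card R \<le> 2"
    "?P \<noteq> {} \<longrightarrow> p \<in> ?P \<and> q \<in> ?P"
    by (rule card_le_4_cases)
  have a2: "2 \<le> a" using card_missed_alpha[OF tri s] by linarith
  have cR: "colourable R (compl_rel F) 2"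
    using colourable_card[of R "compl_rel F"] PR finite_subset[OF PR(2) fP] colourable_mono by blast
  have c1: "colourable (nbrs2 u b \<union> nbrs2 u x) (compl_rel F) a"
    using fin codegree_indep tri by (intro clique_cover_2_independent[OF sym irr]) (auto intro!: indep_card)
  have c2: "colourable ((side u b x - ?P) \<union> nbrs2 b x) (compl_rel F) a"
    using fin finite_side codegree_indep[OF tri(3)] indep_side_diff[OF tri s] side_sub[OF tri s]
    by (intro clique_cover_2_independent[OF sym irr]) (auto intro!: indep_card)
  \<comment> \<open>The vertex \<open>v\<close> extends every independent set of
    \<open>insert r X\<close>, which lowers the bound from \<open>a\<close> to \<open>a - 1\<close>.
    It will be \<open>x\<close> for \<open>?M\<close> and \<open>b\<close> for
    \<open>side x u b\<close>.\<close>
  have absorb: "colourable (insert r X) (compl_rel F) (a - 1)"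
    if r: "r \<in> ?P" and X: "X \<subseteq> V" and d: "F d e" and o: "\<And>y. y \<in> X \<Longrightarrow> \<not> F d y \<and> \<not> F e y"
      and v: "v \<in> V" "\<not> F v r" "v \<noteq> r" "\<And>y. y \<in> X \<Longrightarrow> \<not> F v y" "v \<notin> X" for r X d e v
  proof (rule absorb_clique_cover)
    show "X \<subseteq> V" by fact
    show rV: "r \<in> V" using r side_sub[OF tri s] by blast
    show "y = w" if "y \<in> X" "z \<in> X" "w \<in> X" "F y z" "F z w" for y z w
      using nonnbrs_matching[OF d that(4,5)] o that by blast
    fix I assume I: "I \<subseteq> insert r X" "indep F I"
    have "indep F (insert v I)"
      using I v by (intro indep_insertI) blast+
    then have "card (insert v I) \<le> a" using I X rV v by (intro indep_card) blast+
    moreover have "card (insert v I) = Suc (card I)"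
      using I v X rV fin by (intro card_insert_disjoint) (auto intro: finite_subset)
    ultimately show "card I \<le> a - 1" by simp
  qed
  have plain: "colourable X (compl_rel F) (a - 1)"
    if X: "X \<subseteq> V" and d: "F d e" and o: "\<And>y. y \<in> X \<Longrightarrow> \<not> F d y \<and> \<not> F e y"
      and v: "v \<in> V" "\<And>y. y \<in> X \<Longrightarrow> \<not> F v y" "v \<notin> X" for X d e v
  proof (rule clique_cover_if_2_colourable[OF sym irr])
    show "finite X" using X fin finite_subset by blast
    show "colourable X F 2"
      using nonnbrs_colourable_2[OF d] X o by (elim colourable_mono) (auto simp: nonnbrs_def)
    fix I assume I: "I \<subseteq> X" "indep F I"
    have "indep F (insert v I)"
      using I v by (intro indep_insertI) blast+
    then have "card (insert v I) \<le> a" using I X v by (intro indep_card) blast+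
    moreover have "card (insert v I) = Suc (card I)"
      using I v X fin by (intro card_insert_disjoint) (auto intro: finite_subset)
    ultimately show "card I \<le> a - 1" by simp
  qed
  have Px: "\<not> F x r" "\<not> F b r" "x \<noteq> r" "b \<noteq> r" if "r \<in> ?P" for r
    using that Ps not_in_side[OF tri s] by (auto simp: side_def)
  have xM: "x \<notin> ?M" using tri by simp
  have bS: "\<not> F b y" "\<not> F u y" if "y \<in> side x u b" for y using that by (auto simp: side_def)
  have bnS: "b \<notin> side x u b" using tri by (simp add: side_def)
  have S: "side x u b \<subseteq> V" by (auto simp: side_def)
  have c34: "colourable (?M \<union> (?P \<inter> {p})) (compl_rel F) (a - 1)"
    "colourable (side x u b \<union> (?P \<inter> {q})) (compl_rel F) (a - 1)"
  proof -
    show "colourable (?M \<union> (?P \<inter> {p})) (compl_rel F) (a - 1)"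
    proof (cases "p \<in> ?P")
      case True
      have "colourable (insert p ?M) (compl_rel F) (a - 1)"
        by (rule absorb[OF True _ tri(2) _ tri(6)]) (use Px[OF True] xM in auto)
      then show ?thesis by (elim colourable_mono) auto
    next
      case False
      have "colourable ?M (compl_rel F) (a - 1)"
        by (rule plain[OF _ tri(2) _ tri(6)]) (use xM in auto)
      then show ?thesis using False by (elim colourable_mono) auto
    qed
    show "colourable (side x u b \<union> (?P \<inter> {q})) (compl_rel F) (a - 1)"
    proof (cases "q \<in> ?P")
      case True
      have "colourable (insert q (side x u b)) (compl_rel F) (a - 1)"
        by (rule absorb[OF True S tri(1) _ tri(5)]) (use Px[OF True] bS bnS in auto)
      then show ?thesis by (elim colourable_mono) auto
    next
      case False
      have "colourable (side x u b) (compl_rel F) (a - 1)"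
        by (rule plain[OF S tri(1) _ tri(5)]) (use bS bnS in auto)
      then show ?thesis using False by (elim colourable_mono) auto
    qed
  qed
  \<comment> \<open>The two cliques saved on the matchings pay for the vertices of
    \<open>R\<close>.\<close>
  have "colourable ((nbrs2 u b \<union> nbrs2 u x) \<union> ((side u b x - ?P) \<union> nbrs2 b x) \<union>
      (?M \<union> (?P \<inter> {p})) \<union> (side x u b \<union> (?P \<inter> {q})) \<union> R) (compl_rel F)
      (a + a + (a - 1) + (a - 1) + 2)"
    by (intro colourable_Un c1 c2 c34 cR)
  then show ?thesis
  proof (rule colourable_mono)
    show "V \<subseteq> (nbrs2 u b \<union> nbrs2 u x) \<union> ((side u b x - ?P) \<union> nbrs2 b x) \<union>
      (?M \<union> (?P \<inter> {p})) \<union> (side x u b \<union> (?P \<inter> {q})) \<union> R"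
    proof
      fix y assume y: "y \<in> V"
      show "y \<in> (nbrs2 u b \<union> nbrs2 u x) \<union> ((side u b x - ?P) \<union> nbrs2 b x) \<union>
        (?M \<union> (?P \<inter> {p})) \<union> (side x u b \<union> (?P \<inter> {q})) \<union> R"
      proof (cases "y \<in> ?P")
        case True
        then show ?thesis using PR(1) by blast
      next
        case False
        have "y \<in> nbrs2 u b \<union> nbrs2 u x \<union> nbrs2 b x \<union> side u b x \<union> side x u b \<union> ?M"
          using y unfolding side_def by blast
        then show ?thesis using False by blast
      qed
    qed
  qed (use a2 in linarith)
qed

lemma colourable_7_or_bounds:
  "colourable V F 7 \<or> card V \<le> 7 * a \<and> colourable V (compl_rel F) (4 * a)"
proof (rule disjCI)
  assume neg: "\<not> (card V \<le> 7 * a \<and> colourable V (compl_rel F) (4 * a))"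
  show "colourable V F 7"
  proof (rule ccontr)
    assume n7: "\<not> ?thesis"
    have ar: "arrow p q \<or> arrow q p" if "F p q" for p q
      using colourable_7_if_no_arrow[OF that] n7 by blast
    have codeg: "card (nbrs2 p q) \<le> 5" if "F p q" for p q
    proof -
      have "nbrs2 p q = nbrs2 q p" by blast
      then show ?thesis using ar[OF that] codegree_le_5[of p q] codegree_le_5[of q p] that sym by metis
    qed
    have "\<exists>p\<in>V. \<exists>q\<in>V. F p q"
    proof (rule ccontr)
      assume "\<not> ?thesis"
      then have "colourable V F 1" by (intro colourable_independent) blast
      then show False using n7 colourable_mono[of V F 1 V 7] by simp
    qed
    then obtain u u' where uu: "u \<in> V" "u' \<in> V" "arrow u u'" using ar by blast
    then obtain w1 w2 w3 w4 w5 where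
      w: "{w1, w2, w3, w4, w5} \<subseteq> {x \<in> V. F u x \<and> \<not> F u' x}"
        "F w1 w2" "F w2 w3" "F w3 w4" "F w4 w5" "F w5 w1"
      unfolding arrow_def by blast
    \<comment> \<open>Either equality would leave a triangle on the cycle, hence a K4 with
      \<open>u\<close>.\<close>
    have ne: "w3 \<noteq> w1" "w5 \<noteq> w2"
      using w irr K4_free[of u w1 w4 w5] K4_free[of u w2 w3 w4] sym by auto
    \<comment> \<open>The triangle is \<open>u\<close>, \<open>w2\<close>, \<open>w1\<close>; the
      next vertices of the cycle on either side, \<open>w3\<close> and \<open>w5\<close>, serve as
      \<open>s\<close> and \<open>t\<close>.\<close>
    have tri: "F u w2" "F u w1" "F w2 w1" "u \<in> V" "w2 \<in> V" "w1 \<in> V"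
      using w uu sym by auto
    have s: "w3 \<in> V" "F u w3" "F w2 w3" "w3 \<noteq> w1" using w ne by auto
    have t: "w5 \<in> V" "F w1 w5" "F u w5" "w5 \<noteq> w2" using w ne sym by auto
    show False
      using neg card_V_le[OF tri s t codeg] clique_cover_V[OF tri s codeg] by blast
  qed
qed

end

section \<open>From seven colours to both bounds\<close>

lemma bounds_if_7_colourable:
  assumes sym: "\<And>x y. F x y \<Longrightarrow> F y x" and irr: "\<And>x. \<not> F x x" and fin: "finite V"
    and bound: "\<And>I. I \<subseteq> V \<Longrightarrow> indep F I \<Longrightarrow> card I \<le> w"
    and "colourable V F 7"
  shows "card V \<le> 7 * w \<and> colourable V (compl_rel F) (4 * w)"
proof
  obtain c where c: "proper_colouring V F 7 c" using assms by (auto simp: colourable_def)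
  define C where "C i = {x \<in> V. c x = i}" for i
  have C: "C i \<subseteq> V" "finite (C i)" for i using fin by (auto simp: C_def)
  have ind: "indep F (C i)" for i
    unfolding indep_def
  proof (intro ballI notI)
    fix p q assume pq: "p \<in> C i" "q \<in> C i" "F p q"
    then have "c p \<noteq> c q" using c unfolding C_def proper_colouring_def by blast
    then show False using pq by (simp add: C_def)
  qed
  have V: "V = (\<Union>i<7. C i)" using c by (auto simp: C_def proper_colouring_def)
  have "card V \<le> (\<Sum>i<7. card (C i))" by (subst V) (rule card_UN_le, simp)
  also have "\<dots> \<le> (\<Sum>i<(7::nat). w)" using bound C ind by (intro sum_mono) auto
  finally show "card V \<le> 7 * w" by simp
  have pair: "colourable (C i \<union> C j) (compl_rel F) w" for i j
  proof (rule clique_cover_2_independent[OF sym irr C(2) C(2) ind ind])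
    fix I assume "I \<subseteq> C i \<union> C j" "indep F I"
    then show "card I \<le> w" using bound[of I] C(1)[of i] C(1)[of j] by blast
  qed
  \<comment> \<open>Seven classes make four pairs, the last being class 6 with itself.\<close>
  have "colourable ((C 0 \<union> C 1) \<union> (C 2 \<union> C 3) \<union> (C 4 \<union> C 5) \<union> (C 6 \<union> C 6)) (compl_rel F)
      (w + w + w + w)"
    by (intro colourable_Un pair)
  then show "colourable V (compl_rel F) (4 * w)"
  proof (rule colourable_mono)
    have "{..<7} = {0, 1, 2, 3, 4, 5, 6 :: nat}" by auto
    then show "V \<subseteq> (C 0 \<union> C 1) \<union> (C 2 \<union> C 3) \<union> (C 4 \<union> C 5) \<union> (C 6 \<union> C 6)"
      using V by auto
  qed simp
qed

section \<open>Forbidden subgraphs and passage to the complement\<close>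

lemma contains_induced_fourK1I:
  assumes "{a, b, c, d} \<subseteq> V" "distinct [a, b, c, d]" "\<And>x y. x \<in> {a, b, c, d} \<Longrightarrow> y \<in> {a, b, c, d} \<Longrightarrow> \<not> E x y"
  shows "contains_induced V E fourK1_V fourK1_E"
proof -
  define f where "f i = [a, b, c, d] ! i" for i
  have V4: "fourK1_V = {0, 1, 2, 3}" by (auto simp: fourK1_V_def)
  have "inj_on f fourK1_V"
    using assms(2) unfolding V4 f_def by (auto simp: inj_on_def)
  moreover have f: "f i \<in> {a, b, c, d}" if "i \<in> fourK1_V" for i
    using that unfolding V4 f_def by auto
  then have "f ` fourK1_V \<subseteq> V" using assms(1) by blast
  moreover have "\<forall>i\<in>fourK1_V. \<forall>j\<in>fourK1_V. E (f i) (f j) \<longleftrightarrow> fourK1_E i j"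
    using assms(3)[OF f f] unfolding fourK1_E_def by simp
  ultimately show ?thesis unfolding contains_induced_def by blast
qed

text \<open>In the complement, \<open>a - b - c\<close> is the P3 and \<open>d - e\<close> the P2,
  in the numbering of \<open>P3P2_E\<close>.\<close>

lemma contains_induced_coP3P2I:
  assumes "{a, b, c, d, e} \<subseteq> V" "distinct [a, b, c, d, e]"
    and "\<And>x. x \<in> {a, b, c, d, e} \<Longrightarrow> \<not> E x x"
    and "\<not> E a b" "\<not> E b a" "\<not> E b c" "\<not> E c b" "\<not> E d e" "\<not> E e d"
    and "E a c" "E c a" "\<And>x y. x \<in> {a, b, c} \<Longrightarrow> y \<in> {d, e} \<Longrightarrow> E x y \<and> E y x"
  shows "contains_induced V E coP3P2_V coP3P2_E"
proof -
  define f where "f i = [a, b, c, d, e] ! i" for i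
  have V5: "coP3P2_V = {0, 1, 2, 3, 4}" by (auto simp: coP3P2_V_def)
  have f: "f 0 = a" "f 1 = b" "f (Suc 0) = b" "f 2 = c" "f 3 = d" "f 4 = e"
    by (simp_all add: f_def)
  have "inj_on f coP3P2_V"
    using assms(2) unfolding V5 f_def by (auto simp: inj_on_def)
  moreover have "f ` coP3P2_V \<subseteq> V" using assms(1) unfolding V5 by (simp add: f)
  moreover have "\<not> E a a" "\<not> E b b" "\<not> E c c" "\<not> E d d" "\<not> E e e"
    using assms(3) by simp_all
  moreover have "E a d" "E d a" "E a e" "E e a" "E b d" "E d b" "E b e" "E e b" "E c d" "E d c"
    "E c e" "E e c"
    using assms(12) by simp_all
  ultimately show ?thesis
    using assms(4-11) unfolding contains_induced_def
    by (intro exI[of _ f]) (simp add: V5 f coP3P2_E_def P3P2_E_def doubleton_eq_iff)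
qed

lemma card_clique_le:
  assumes "finite V" "is_clique V E K"
  shows "card K \<le> clique_number V E"
proof -
  have "{K. is_clique V E K} \<subseteq> Pow V" by (auto simp: is_clique_def)
  then have "finite {K. is_clique V E K}" using assms(1) finite_subset by blast
  then show ?thesis using assms(2) unfolding clique_number_def by (intro Max_ge) auto
qed

theorem theorem1p4:
  fixes V :: "'a set" and E :: "'a \<Rightarrow> 'a \<Rightarrow> bool"
  assumes "simple_graph V E"
    and "\<not> contains_induced V E fourK1_V fourK1_E"
    and "\<not> contains_induced V E coP3P2_V coP3P2_E"
  shows "card V \<le> 7 * clique_number V E \<and> chromatic_number V E \<le> 4 * clique_number V E"
proof -
  have fin: "finite V" and Esym: "\<And>x y. x \<in> V \<Longrightarrow> y \<in> V \<Longrightarrow> E x y \<longleftrightarrow> E y x"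
    and Eirr: "\<And>x. x \<in> V \<Longrightarrow> \<not> E x x"
    using assms(1) by (auto simp: simple_graph_def)
  \<comment> \<open>\<open>E\<close> is controlled only on \<open>V\<close>; cutting
    \<open>F\<close> down to \<open>V\<close> makes it symmetric and irreflexive on the whole type,
    as the locale requires.\<close>
  define F where "F x y \<longleftrightarrow> x \<in> V \<and> y \<in> V \<and> x \<noteq> y \<and> \<not> E x y" for x y
  have Fsym: "F y x" if "F x y" for x y using that Esym unfolding F_def by blast
  have Firr: "\<not> F x x" for x by (simp add: F_def)
  interpret K4_P3P2_free F V
  proof
    fix a b c d assume F: "F a b" "F a c" "F a d" "F b c" "F b d" "F c d"
    have V: "{a, b, c, d} \<subseteq> V" "distinct [a, b, c, d]" using F by (auto simp: F_def)
    have adj: "x = y \<or> F x y" if "x \<in> {a, b, c, d}" "y \<in> {a, b, c, d}" for x y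
      using that by (elim insertE emptyE) (simp_all add: F F[THEN Fsym])
    have "\<not> E x y" if xy: "x \<in> {a, b, c, d}" "y \<in> {a, b, c, d}" for x y
    proof -
      have "x \<in> V" using V(1) xy(1) by blast
      then show ?thesis using adj[OF xy] Eirr[of x] by (auto simp: F_def)
    qed
    with V have "contains_induced V E fourK1_V fourK1_E"
      by (rule contains_induced_fourK1I)
    then show False using assms(2) by blast
  next
    fix a b c d e
    assume F: "F a b" "F b c" "a \<noteq> c" "\<not> F a c" "F d e" "\<not> F a d" "\<not> F a e" "\<not> F b d" "\<not> F b e"
      "\<not> F c d" "\<not> F c e"
    then have V: "a \<in> V" "b \<in> V" "c \<in> V" "d \<in> V" "e \<in> V" by (auto simp: F_def)
    have ne: "a \<noteq> d" "a \<noteq> e" "b \<noteq> d" "b \<noteq> e" "c \<noteq> d" "c \<noteq> e" using F Fsym by blast+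
    have "E x y \<and> E y x" if "x \<in> {a, b, c}" "y \<in> {d, e}" for x y
    proof -
      have "\<not> F x y" "x \<in> V" "y \<in> V" "x \<noteq> y" using that F V ne by auto
      then show ?thesis using Esym[of x y] unfolding F_def by blast
    qed
    moreover have "E a c" "E c a" using F(3,4) V Esym[of a c] unfolding F_def by blast+
    moreover have "\<not> E a b" "\<not> E b a" "\<not> E b c" "\<not> E c b" "\<not> E d e" "\<not> E e d"
      using F(1,2,5) F(1,2,5)[THEN Fsym] by (auto simp: F_def)
    moreover have "\<not> E x x" if "x \<in> {a, b, c, d, e}" for x using that V Eirr by blast
    moreover have "distinct [a, b, c, d, e]" "{a, b, c, d, e} \<subseteq> V"
      using F(1,2,3,5) ne V by (auto simp: F_def)
    ultimately have "contains_induced V E coP3P2_V coP3P2_E"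
      by (intro contains_induced_coP3P2I)
    then show False using assms(3) by blast
  qed (use fin Fsym Firr in auto)
  have bound: "card I \<le> clique_number V E" if "I \<subseteq> V" "indep F I" for I
  proof (rule card_clique_le[OF fin])
    show "is_clique V E I" using that unfolding is_clique_def indep_def F_def by blast
  qed
  have "colourable V F 7 \<or> card V \<le> 7 * clique_number V E \<and>
    colourable V (compl_rel F) (4 * clique_number V E)"
  proof (cases "\<exists>u v p q r. F u v \<and> F p q \<and> F p r \<and> F q r \<and> \<not> F u p \<and> \<not> F u q \<and> \<not> F u r \<and>
      \<not> F v p \<and> \<not> F v q \<and> \<not> F v r")
    case True
    then show ?thesis using colourable_7_if_K3_K2 by blast
  next
    case False
    interpret K4_P3P2_K3K2_free F V "clique_number V E"
      by unfold_locales (use False bound in blast)+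
    show ?thesis by (rule colourable_7_or_bounds)
  qed
  then have main: "card V \<le> 7 * clique_number V E"
    "colourable V (compl_rel F) (4 * clique_number V E)"
    using bounds_if_7_colourable[of F V "clique_number V E"] Fsym Firr fin bound by blast+
  then obtain c where "proper_colouring V (compl_rel F) (4 * clique_number V E) c"
    by (auto simp: colourable_def)
  then have "\<forall>x\<in>V. c x < 4 * clique_number V E"
    "\<forall>x\<in>V. \<forall>y\<in>V. x \<noteq> y \<and> \<not> F x y \<longrightarrow> c x \<noteq> c y"
    unfolding proper_colouring_def by blast+
  moreover have "x \<noteq> y \<and> \<not> F x y" if "x \<in> V" "E x y" for x y
    using that Eirr[of x] by (auto simp: F_def)
  ultimately have "proper_colouring V E (4 * clique_number V E) c"
    unfolding proper_colouring_def by blast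
  then have "chromatic_number V E \<le> 4 * clique_number V E"
    unfolding chromatic_number_def by (intro Least_le) blast
  then show ?thesis using main by blast
qed

end
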